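(* The Galois factorization of a word $T$ over a totally ordered alphabet can be computed in $O(|T|)$ time and $O(1)$ additional working space, excluding the space for the output.
   Context: Alternating order: for words $S,T$ with $S^\omega\neq T^\omega$ ($X^\omega$ is the infinite repetition of $X$), let $j$ be the first position with $S^\omega[j]\neq T^\omega[j]$; then $S\prec_{\mathrm{alt}}T$ if either $j$ is odd and $S^\omega[j]<T^\omega[j]$, or $j$ is even and $S^\omega[j]>T^\omega[j]$. Write $S=_{\mathrm{alt}}T$ if $S^\omega=T^\omega$, and $S\preceq_{\mathrm{alt}}T$ if $S\prec_{\mathrm{alt}}T$ or $S=_{\mathrm{alt}}T$ ($\succeq_{\mathrm{alt}}$ is the reverse). A word is Galois if it is strictly smaller with respect to $\prec_{\mathrm{alt}}$ than all its other cyclic rotations. The Galois factorization of $T$ is the (unique) factorization $T=G_1G_2\cdots G_k$ with each $G_i$ Galois and $G_1\succeq_{\mathrm{alt}}G_2\succeq_{\mathrm{alt}}\cdots\succeq_{\mathrm{alt}}G_k$. The model is the word RAM with read-only input and constant-time symbol comparisons. *)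

theory Defs
  imports "HOL-Library.Landau_Symbols"
begin

section \<open>Alternating order and Galois words\<close>

text \<open>
  Positions are counted from 0, whereas the alternating order is usually stated with positions
  counted from 1: an odd position there is an even index here.
\<close>

definition inf_power :: "'a list \<Rightarrow> nat \<Rightarrow> 'a" where
  "inf_power S j = S ! (j mod length S)"

definition alt_less :: "'a::linorder list \<Rightarrow> 'a list \<Rightarrow> bool" where
  "alt_less S T \<longleftrightarrow>
     (\<exists>j. (\<forall>i<j. inf_power S i = inf_power T i) \<and>
          (even j \<and> inf_power S j < inf_power T j \<or> odd j \<and> inf_power S j > inf_power T j))"

definition alt_eq :: "'a list \<Rightarrow> 'a list \<Rightarrow> bool" where
  "alt_eq S T \<longleftrightarrow> inf_power S = inf_power T"

definition alt_le :: "'a::linorder list \<Rightarrow> 'a list \<Rightarrow> bool" where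
  "alt_le S T \<longleftrightarrow> alt_less S T \<or> alt_eq S T"

text \<open>
  The other rotations of \<open>G\<close> are those by a nontrivial offset, even where two offsets give the
  same word; a Galois word is therefore primitive, and \<open>[a, a]\<close> is not Galois.  Without this,
  \<open>[a, a]\<close> would have two Galois factorizations.
\<close>

definition galois :: "'a::linorder list \<Rightarrow> bool" where
  "galois G \<longleftrightarrow> G \<noteq> [] \<and> (\<forall>k. 0 < k \<and> k < length G \<longrightarrow> alt_less G (rotate k G))"

definition galois_factorization :: "'a::linorder list \<Rightarrow> 'a list list \<Rightarrow> bool" where
  "galois_factorization T Gs \<longleftrightarrow>
     concat Gs = T \<and> (\<forall>G\<in>set Gs. galois G) \<and> successively (\<lambda>G H. alt_le H G) Gs"


section \<open>Word RAM with a read-only text\<close>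

text \<open>
  A machine word is a natural number below \<open>2 ^ w\<close>.  A program has finitely many registers,
  named directly in its instructions, and a random access memory addressed by words.  The text
  is not stored in memory: it can only be accessed by comparing the symbols at two positions
  held in registers.  The output is a write-only sequence of words; a factorization of the text
  is output as the lengths of its factors, which determine it given the text.
\<close>

datatype binop = Add | Sub | Mul | Div | Mod | And | Or | Xor | Shl | Shr

text \<open>The type parameter \<open>'r\<close> is the type of register names; labels are program positions.\<close>

datatype (regs: 'r) instr =
    Const 'r nat
  | Move 'r 'r
  | Op binop 'r 'r 'r
  | Load 'r 'r
  | Store 'r 'r
  | Jump nat
  | JumpEq 'r 'r nat
  | JumpLess 'r 'r nat
  | JumpSymEq 'r 'r nat
  | JumpSymLess 'r 'r nat
  | Emit 'r
  | Halt

type_synonym program = "nat instr list"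

text \<open>The field \<open>touched\<close> records the memory addresses read or written so far.\<close>

record config =
  pc :: nat
  reg :: "nat \<Rightarrow> nat"
  mem :: "nat \<Rightarrow> nat"
  touched :: "nat set"
  out :: "nat list"

text \<open>Arithmetic is modulo \<open>2 ^ w\<close>; subtraction wraps around.\<close>

fun eval_binop :: "nat \<Rightarrow> binop \<Rightarrow> nat \<Rightarrow> nat \<Rightarrow> nat" where
  "eval_binop w Add x y = take_bit w (x + y)"
| "eval_binop w Sub x y = nat (take_bit w (int x - int y))"
| "eval_binop w Mul x y = take_bit w (x * y)"
| "eval_binop w Div x y = take_bit w (x div y)"
| "eval_binop w Mod x y = take_bit w (x mod y)"
| "eval_binop w And x y = take_bit w (Bit_Operations.and x y)"
| "eval_binop w Or x y = take_bit w (Bit_Operations.or x y)"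
| "eval_binop w Xor x y = take_bit w (Bit_Operations.xor x y)"
| "eval_binop w Shl x y = take_bit w (push_bit y x)"
| "eval_binop w Shr x y = take_bit w (drop_bit y x)"

definition set_reg :: "nat \<Rightarrow> nat \<Rightarrow> config \<Rightarrow> config" where
  "set_reg d x c = c\<lparr>pc := Suc (pc c), reg := (reg c)(d := x)\<rparr>"

definition branch :: "bool \<Rightarrow> nat \<Rightarrow> config \<Rightarrow> config" where
  "branch b l c = c\<lparr>pc := (if b then l else Suc (pc c))\<rparr>"

text \<open>
  \<open>None\<close> means that no step is possible, either because the machine has halted or because a
  symbol outside the text was requested.
\<close>

fun exec :: "nat \<Rightarrow> 'a::linorder list \<Rightarrow> nat instr \<Rightarrow> config \<Rightarrow> config option" where
  "exec w T (Const d k) c = Some (set_reg d (take_bit w k) c)"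
| "exec w T (Move d a) c = Some (set_reg d (reg c a) c)"
| "exec w T (Op f d a b) c = Some (set_reg d (eval_binop w f (reg c a) (reg c b)) c)"
| "exec w T (Load d a) c =
     Some ((set_reg d (mem c (reg c a)) c)\<lparr>touched := insert (reg c a) (touched c)\<rparr>)"
| "exec w T (Store a s) c =
     Some (c\<lparr>pc := Suc (pc c), mem := (mem c)(reg c a := reg c s),
             touched := insert (reg c a) (touched c)\<rparr>)"
| "exec w T (Jump l) c = Some (branch True l c)"
| "exec w T (JumpEq a b l) c = Some (branch (reg c a = reg c b) l c)"
| "exec w T (JumpLess a b l) c = Some (branch (reg c a < reg c b) l c)"
| "exec w T (JumpSymEq a b l) c =
     (if reg c a < length T \<and> reg c b < length T
      then Some (branch (T ! reg c a = T ! reg c b) l c) else None)"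
| "exec w T (JumpSymLess a b l) c =
     (if reg c a < length T \<and> reg c b < length T
      then Some (branch (T ! reg c a < T ! reg c b) l c) else None)"
| "exec w T (Emit a) c = Some (c\<lparr>pc := Suc (pc c), out := out c @ [reg c a]\<rparr>)"
| "exec w T Halt c = None"

definition step :: "nat \<Rightarrow> 'a::linorder list \<Rightarrow> program \<Rightarrow> config \<Rightarrow> config option" where
  "step w T p c = (if pc c < length p then exec w T (p ! pc c) c else None)"

fun run :: "nat \<Rightarrow> 'a::linorder list \<Rightarrow> program \<Rightarrow> nat \<Rightarrow> config \<Rightarrow> config option" where
  "run w T p 0 c = Some c"
| "run w T p (Suc t) c = Option.bind (step w T p c) (run w T p t)"

text \<open>Register 0 initially holds the length of the text; everything else is 0.\<close>

definition init_config :: "'a list \<Rightarrow> config" where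
  "init_config T =
     \<lparr>pc = 0, reg = (\<lambda>_. 0)(0 := length T), mem = (\<lambda>_. 0), touched = {}, out = []\<rparr>"

definition halts_after :: "nat \<Rightarrow> 'a::linorder list \<Rightarrow> program \<Rightarrow> nat \<Rightarrow> config \<Rightarrow> bool" where
  "halts_after w T p t c \<longleftrightarrow>
     run w T p t (init_config T) = Some c \<and> pc c < length p \<and> p ! pc c = Halt"

text \<open>Working space in words: the registers of the program and the memory cells accessed.\<close>

definition space_used :: "program \<Rightarrow> config \<Rightarrow> nat" where
  "space_used p c = card (\<Union>i\<in>set p. regs i) + card (touched c)"

end

theory Submission
  imports Defs "HOL-Library.Option_ord"
begin

text \<open>
  The algorithm adapts Duval's algorithm for the Lyndon factorization.  The text is regarded as
  an infinite word that continues with a least symbol \<open>None\<close>.  The scan extends a prefix of the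
  rest of the text as long as none of its suffixes is smaller than it.  A border of even length
  bounds the next symbol from below, one of odd length from above, and of all borders whose
  length has a given parity the longest one gives the strongest bound.  So it suffices to
  maintain the shortest period of each parity.  When a bound is violated by a period \<open>q\<close>,
  the prefix of length \<open>q\<close> is a Galois word or the square of one.  Copies of this Galois word are
  split off, in a number that makes the remaining text smaller than its infinite power; this
  leaves less than two copies to be scanned again, and the running time is linear.
\<close>


section \<open>The alternating order on infinite words\<close>

definition lt_at :: "nat \<Rightarrow> 'b::linorder \<Rightarrow> 'b \<Rightarrow> bool" where
  "lt_at k x y \<longleftrightarrow> (if even k then x < y else y < x)"

definition seq_less :: "(nat \<Rightarrow> 'b::linorder) \<Rightarrow> (nat \<Rightarrow> 'b) \<Rightarrow> bool" where
  "seq_less X Y \<longleftrightarrow> (\<exists>j. (\<forall>i<j. X i = Y i) \<and> lt_at j (X j) (Y j))"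

definition shift :: "nat \<Rightarrow> (nat \<Rightarrow> 'b) \<Rightarrow> nat \<Rightarrow> 'b" where
  "shift k X = (\<lambda>i. X (i + k))"

definition omega :: "nat \<Rightarrow> (nat \<Rightarrow> 'b) \<Rightarrow> nat \<Rightarrow> 'b" where
  "omega h Z = (\<lambda>i. Z (i mod h))"

lemma lt_at_parity: "even (j + k) \<Longrightarrow> lt_at j x y = lt_at k x y"
  and lt_at_swap: "odd (j + k) \<Longrightarrow> lt_at j x y = lt_at k y x"
  by (auto simp: lt_at_def)

lemma lt_at_irrefl [simp]: "\<not> lt_at k x x"
  by (simp add: lt_at_def)

lemma lt_at_asym: "lt_at k x y \<Longrightarrow> \<not> lt_at k y x"
  by (auto simp: lt_at_def split: if_splits)

lemma lt_at_total: "x \<noteq> y \<Longrightarrow> lt_at k x y \<or> lt_at k y x"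
  by (auto simp: lt_at_def)

lemma lt_at_trans: "lt_at k x y \<Longrightarrow> lt_at k y z \<Longrightarrow> lt_at k x z"
  by (auto simp: lt_at_def split: if_splits)

lemma not_lt_at_trans: "\<not> lt_at k y x \<Longrightarrow> \<not> lt_at k z y \<Longrightarrow> \<not> lt_at k z x"
  by (auto simp: lt_at_def split: if_splits)

lemma seq_lessI:
  "(\<And>i. i < j \<Longrightarrow> X i = Y i) \<Longrightarrow> lt_at j (X j) (Y j) \<Longrightarrow> seq_less X Y"
  by (auto simp: seq_less_def)

lemma seq_lessE:
  assumes "seq_less X Y"
  obtains j where "\<And>i. i < j \<Longrightarrow> X i = Y i" "lt_at j (X j) (Y j)"
  using assms by (auto simp: seq_less_def)

lemma seq_less_asym:
  assumes "seq_less X Y"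
  shows "\<not> seq_less Y X"
proof
  obtain j where j: "\<And>i. i < j \<Longrightarrow> X i = Y i" "lt_at j (X j) (Y j)"
    using assms by (rule seq_lessE) auto
  assume "seq_less Y X"
  then obtain k where k: "\<And>i. i < k \<Longrightarrow> Y i = X i" "lt_at k (Y k) (X k)"
    by (rule seq_lessE) auto
  show False
    using j k by (metis linorder_less_linear lt_at_asym lt_at_irrefl)
qed

lemma seq_less_trans:
  assumes "seq_less X Y" "seq_less Y Z"
  shows "seq_less X Z"
proof -
  obtain j where j: "\<And>i. i < j \<Longrightarrow> X i = Y i" "lt_at j (X j) (Y j)"
    using assms(1) by (rule seq_lessE) auto
  obtain k where k: "\<And>i. i < k \<Longrightarrow> Y i = Z i" "lt_at k (Y k) (Z k)"
    using assms(2) by (rule seq_lessE) auto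
  show ?thesis
  proof (rule seq_lessI[of "min j k"])
    show "X i = Z i" if "i < min j k" for i using that j(1) k(1) by simp
    show "lt_at (min j k) (X (min j k)) (Z (min j k))"
      using j k lt_at_trans by (metis linorder_less_linear min.absorb3 min.absorb4 min.idem)
  qed
qed

lemma first_difference:
  fixes X :: "nat \<Rightarrow> 'b"
  assumes "X \<noteq> Y"
  obtains j where "\<And>i. i < j \<Longrightarrow> X i = Y i" "X j \<noteq> Y j"
proof -
  have "\<exists>j. X j \<noteq> Y j" using assms by auto
  then obtain j where "X j \<noteq> Y j" "\<forall>i<j. X i = Y i"
    using exists_least_iff[of "\<lambda>j. X j \<noteq> Y j"] by auto
  then show ?thesis using that by auto
qed

lemma seq_less_total:
  assumes "X \<noteq> Y"
  shows "seq_less X Y \<or> seq_less Y X"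
proof -
  obtain j where j: "\<And>i. i < j \<Longrightarrow> X i = Y i" "X j \<noteq> Y j"
    using assms by (rule first_difference) auto
  then show ?thesis using lt_at_total[of "X j" "Y j" j] by (metis seq_lessI)
qed

text \<open>Deleting a common prefix of odd length changes the parity of the first difference, so
  the direction of the comparison is reversed.\<close>

lemma seq_less_odd_prefix:
  assumes "\<And>i. i < k \<Longrightarrow> X i = Y i" "odd k" "seq_less (shift k X) (shift k Y)"
  shows "seq_less Y X"
proof -
  obtain j where j: "\<And>i. i < j \<Longrightarrow> X (i + k) = Y (i + k)" "lt_at j (X (j + k)) (Y (j + k))"
    using assms(3) unfolding shift_def by (rule seq_lessE) auto
  show ?thesis
  proof (rule seq_lessI[of "j + k"])
    show "Y i = X i" if "i < j + k" for i
      using assms(1)[of i] j(1)[of "i - k"] that by (cases "i < k") auto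
    show "lt_at (j + k) (Y (j + k)) (X (j + k))"
      using j(2) lt_at_swap[of "j + k" j] assms(2) by auto
  qed
qed

text \<open>
  \<open>Y\<close> stands for the infinite power of the previous factor, \<open>Z\<close> for the remaining text and \<open>G\<close>
  for the infinite power of the next factor.
\<close>

lemma prefix_less:
  assumes "seq_less Z Y" "\<And>i. i < r \<Longrightarrow> Z i = G i" "i < r" "Y i \<noteq> G i"
  shows "seq_less G Y"
proof -
  obtain j where j: "\<And>i. i < j \<Longrightarrow> Z i = Y i" "lt_at j (Z j) (Y j)"
    using assms(1) by (rule seq_lessE) auto
  have "j < r" using j(1)[of i] assms by (metis linorder_not_less order_less_le_trans)
  then show ?thesis using j assms(2) by (intro seq_lessI[of j]) auto
qed

text \<open>If \<open>Y\<close> were below \<open>G\<close>, \<open>prefix_less\<close> would place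
  their first difference \<open>j\<close> at \<open>r\<close> or later. As \<open>G\<close> has
  period \<open>r\<close>, the same two symbols then separate \<open>shift r Y\<close> from
  \<open>Y\<close> at \<open>j - r\<close>; since \<open>r\<close> is even the direction stays, and
  \<open>Y\<close> is not minimal among its shifts.\<close>

lemma next_le_even:
  assumes min: "\<And>k. \<not> seq_less (shift k Y) Y"
    and "seq_less Z Y" "even r" "0 < r" and G: "\<And>i. G (i + r) = G i"
    and Z: "\<And>i. i < r \<Longrightarrow> Z i = G i"
  shows "\<not> seq_less Y G"
proof
  assume less: "seq_less Y G"
  then obtain j where j: "\<And>i. i < j \<Longrightarrow> Y i = G i" "lt_at j (Y j) (G j)"
    by (rule seq_lessE) auto
  have "\<forall>i<r. Y i = G i"
    using prefix_less[OF assms(2) Z] seq_less_asym[OF less] by blast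
  then have "r \<le> j" using j(2) by (metis linorder_not_less lt_at_irrefl)
  have "seq_less (shift r Y) Y"
  proof (rule seq_lessI[of "j - r"])
    show "shift r Y i = Y i" if "i < j - r" for i
      using j(1)[of i] j(1)[of "i + r"] that G[of i] by (auto simp: shift_def)
    have "G j = Y (j - r)"
      using j(1)[of "j - r"] G[of "j - r"] \<open>r \<le> j\<close> \<open>0 < r\<close> by auto
    then show "lt_at (j - r) (shift r Y (j - r)) (Y (j - r))"
      using j(2) \<open>r \<le> j\<close> \<open>even r\<close> lt_at_parity[of "j - r" j] by (auto simp: shift_def)
  qed
  then show False using min by blast
qed

text \<open>
  If \<open>Y\<close> starts with the odd prefix as well, \<open>shift q Y \<succeq> Y \<succ> Z \<succ> shift q Z\<close> is reversed
  by the prefix.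
\<close>

lemma next_le_odd:
  assumes min: "\<And>k. \<not> seq_less (shift k Y) Y"
    and "seq_less Z Y" "odd q" and Z: "\<And>i. i < q \<Longrightarrow> Z i = G i"
    and "seq_less (shift q Z) Z"
  shows "\<not> seq_less Y G"
proof
  assume less: "seq_less Y G"
  have Y: "\<forall>i<q. Y i = G i"
    using prefix_less[OF assms(2) Z] seq_less_asym[OF less] by blast
  have "seq_less (shift q Z) Y" using assms(5,2) by (rule seq_less_trans)
  then have "seq_less (shift q Z) (shift q Y)"
    using min[of q] seq_less_total[of Y "shift q Y"] seq_less_trans by metis
  then have "seq_less Y Z"
    using Y Z \<open>odd q\<close> by (intro seq_less_odd_prefix[of q Z Y]) auto
  then show False using assms(2) seq_less_asym by blast
qed


section \<open>Periods of prefixes\<close>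

definition per :: "(nat \<Rightarrow> 'b) \<Rightarrow> nat \<Rightarrow> nat \<Rightarrow> bool" where
  "per Z p m \<longleftrightarrow> (\<forall>t. p \<le> t \<and> t < m \<longrightarrow> Z t = Z (t - p))"

text \<open>The suffix starting at \<open>i\<close> agrees with the prefix up to text position
  \<open>t\<close>, which is index \<open>t - i\<close> of that comparison; hence the parity of
  \<open>t - i\<close> decides the direction.\<close>

definition pregalois :: "(nat \<Rightarrow> 'b::linorder) \<Rightarrow> nat \<Rightarrow> bool" where
  "pregalois Z m \<longleftrightarrow>
     (\<forall>i t. 0 < i \<and> i \<le> t \<and> t < m \<and> per Z i t \<longrightarrow> \<not> lt_at (t - i) (Z t) (Z (t - i)))"

definition least_per :: "(nat \<Rightarrow> 'b) \<Rightarrow> nat \<Rightarrow> nat \<Rightarrow> bool" where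
  "least_per Z m p \<longleftrightarrow>
     0 < p \<and> p \<le> m \<and> per Z p m \<and> (\<forall>i. 0 < i \<and> i < p \<and> even (i + p) \<longrightarrow> \<not> per Z i m)"

text \<open>The value \<open>0\<close> encodes that no such period exists, as in register 4 of the
  program.\<close>

definition other_per :: "(nat \<Rightarrow> 'b) \<Rightarrow> nat \<Rightarrow> nat \<Rightarrow> nat \<Rightarrow> bool" where
  "other_per Z m q p \<longleftrightarrow>
     (if p = 0 then \<forall>i. 0 < i \<and> i \<le> m \<and> odd (i + q) \<longrightarrow> \<not> per Z i m
      else least_per Z m p \<and> odd (q + p))"

definition galois_seq :: "(nat \<Rightarrow> 'b::linorder) \<Rightarrow> nat \<Rightarrow> bool" where
  "galois_seq Z h \<longleftrightarrow>
     0 < h \<and> (\<forall>k. 0 < k \<and> k < h \<longrightarrow> seq_less (omega h Z) (shift k (omega h Z)))"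

lemma per_mono: "per Z p m \<Longrightarrow> m' \<le> m \<Longrightarrow> per Z p m'"
  by (auto simp: per_def)

section \<open>Elementary properties of periods and of the scan invariant\<close>

lemma per_Suc: "per Z p (Suc m) \<longleftrightarrow> per Z p m \<and> (p \<le> m \<longrightarrow> Z m = Z (m - p))"
  by (auto simp: per_def less_Suc_eq)

lemma per_trivial: "m \<le> p \<Longrightarrow> per Z p m"
  by (auto simp: per_def)

lemma per_add: "per Z p m \<Longrightarrow> per Z q m \<Longrightarrow> per Z (p + q) m"
  unfolding per_def by (metis add_leD1 diff_diff_left le_add_diff_inverse2 le_diff_conv2
      less_imp_diff_less add.commute)

lemma per_mod:
  assumes "per Z h m" "0 < h"
  shows "x < m \<Longrightarrow> Z (x mod h) = Z x"
proof (induction x rule: less_induct)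
  case (less x)
  show ?case
  proof (cases "x < h")
    case False
    then have "Z x = Z (x - h)" using assms(1) less.prems by (auto simp: per_def)
    moreover have "x mod h = (x - h) mod h" using False by (simp add: mod_if)
    ultimately show ?thesis using less.IH[of "x - h"] less.prems False assms(2) by auto
  qed auto
qed

lemma not_per_obtain:
  assumes "\<not> per Z i m"
  obtains t where "i \<le> t" "t < m" "per Z i t" "Z t \<noteq> Z (t - i)"
proof -
  let ?P = "\<lambda>t. i \<le> t \<and> t < m \<and> Z t \<noteq> Z (t - i)"
  have "\<exists>t. ?P t" using assms by (auto simp: per_def)
  then obtain t where "?P t" "\<forall>u<t. \<not> ?P u"
    using exists_least_iff[of ?P] by auto
  then show ?thesis using that[of t] by (auto simp: per_def)
qed

lemma pregalois_mono: "pregalois Z m \<Longrightarrow> m' \<le> m \<Longrightarrow> pregalois Z m'"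
  by (auto simp: pregalois_def)

lemma pregalois_mismatch:
  assumes "pregalois Z m" "0 < i" "i \<le> t" "t < m" "per Z i t" "Z t \<noteq> Z (t - i)"
  shows "lt_at (t - i) (Z (t - i)) (Z t)"
  using assms lt_at_total[of "Z t" "Z (t - i)" "t - i"] by (auto simp: pregalois_def)

text \<open>
  Among the periods of one parity, the shortest one imposes the strongest condition on the next
  symbol; this is why two periods suffice.
\<close>

lemma shorter_period_dominates:
  assumes pg: "pregalois Z m" and p: "per Z p m" "0 < p" and i: "per Z i m" "p \<le> i" "i \<le> m"
    and par: "even (i + p)"
  shows "\<not> lt_at (m - i) (Z (m - p)) (Z (m - i))"
proof (cases "p = i")
  case False
  \<comment> \<open>The shorter border is also a border of the longer one, so \<open>d\<close> is a
    period of the prefix of length \<open>m - p\<close>; \<open>pregalois\<close> then applies at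
    position \<open>m - p\<close>.\<close>
  define d where "d = i - p"
  have d: "0 < d" "d + p = i" using False i by (auto simp: d_def)
  have "per Z d (m - p)"
    unfolding per_def
  proof (intro allI impI)
    fix t assume t: "d \<le> t \<and> t < m - p"
    have "Z t = Z (t + p)" using p t d i by (auto simp: per_def)
    also have "\<dots> = Z (t + p - i)" using i t d by (auto simp: per_def)
    finally show "Z t = Z (t - d)" using d by (metis add_diff_cancel_right)
  qed
  then have "\<not> lt_at (m - p - d) (Z (m - p)) (Z (m - p - d))"
    using pg[unfolded pregalois_def, rule_format, of d "m - p"] d i p by auto
  moreover have "m - p - d = m - i" using d by auto
  ultimately show ?thesis by simp
qed auto

text \<open>At the first failure \<open>t \<ge> q\<close>, \<open>pregalois\<close> puts
  \<open>Z (t - i)\<close> before \<open>Z t = Z (t - q)\<close>. Up to \<open>t\<close> both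
  \<open>i\<close> and \<open>q\<close> are periods, and the dominance of the shorter one excludes
  just this order.\<close>

lemma period_persists:
  assumes pg: "pregalois Z m" and "0 < i" "i < q" "q \<le> m" "even (i + q)" "per Z i q" "per Z q m"
  shows "per Z i m"
proof (rule ccontr)
  assume "\<not> per Z i m"
  then obtain t where t: "i \<le> t" "t < m" "per Z i t" "Z t \<noteq> Z (t - i)"
    by (rule not_per_obtain)
  have qt: "q \<le> t" using t assms(6) by (auto simp: per_def not_le)
  have "lt_at (t - i) (Z (t - i)) (Z t)" using pregalois_mismatch pg assms(2) t by blast
  then have "lt_at (t - q) (Z (t - i)) (Z t)"
    using lt_at_parity[of "t - q" "t - i"] qt assms(3,5) by auto
  moreover have "\<not> lt_at (t - q) (Z (t - i)) (Z (t - q))"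
    using assms t qt pregalois_mono[OF pg, of t] per_mono[OF assms(7), of t]
    by (intro shorter_period_dominates) auto
  moreover have "Z t = Z (t - q)" using assms(7) qt t by (auto simp: per_def)
  ultimately show False by simp
qed

text \<open>By minimality \<open>p \<le> i\<close>, so the bound from \<open>p\<close> implies the
  one from \<open>i\<close>. If it holds strictly, the symbol differs from \<open>Z (m - i)\<close>
  as well: the periods of one parity die together with their shortest one.\<close>

lemma least_per_next:
  assumes pg: "pregalois Z m" and p: "least_per Z m p"
    and ok: "\<not> lt_at (m - p) (Z m) (Z (m - p))"
    and i: "0 < i" "i \<le> m" "even (i + p)" "per Z i m"
  shows "\<not> lt_at (m - i) (Z m) (Z (m - i))"
    and "Z m \<noteq> Z (m - p) \<Longrightarrow> Z m \<noteq> Z (m - i)"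
proof -
  have "p \<le> i" using p i by (auto simp: least_per_def not_less[symmetric])
  then have dom: "\<not> lt_at (m - i) (Z (m - p)) (Z (m - i))"
    using assms by (intro shorter_period_dominates) (auto simp: least_per_def)
  have par: "lt_at (m - p) = (lt_at (m - i) :: 'a \<Rightarrow> _)"
    using lt_at_parity[of "m - p" "m - i"] i \<open>p \<le> i\<close> by fastforce
  show "\<not> lt_at (m - i) (Z m) (Z (m - i))"
    using dom ok par not_lt_at_trans by metis
  show "Z m \<noteq> Z (m - i)" if "Z m \<noteq> Z (m - p)"
    using that dom ok par lt_at_total by metis
qed

text \<open>\<open>A\<close> gives a lower bound and \<open>B\<close> an upper bound because
  \<open>m - A\<close> is even and \<open>m - B\<close> odd. One more symbol flips the parity of the
  length, so the two exchange roles. A lost \<open>B\<close> is replaced by the trivial period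
  \<open>Suc m\<close>, a lost \<open>A\<close> by \<open>0\<close>.\<close>

lemma pregalois_step:
  assumes pg: "pregalois Z m" and A: "least_per Z m A" "even (m + A)" and B: "other_per Z m A B"
    and okA: "Z (m - A) \<le> Z m" and okB: "B \<noteq> 0 \<Longrightarrow> Z m \<le> Z (m - B)"
  defines "A' \<equiv> if B = 0 \<or> Z m < Z (m - B) then Suc m else B"
    and "B' \<equiv> if Z m = Z (m - A) then A else 0"
  shows "pregalois Z (Suc m)" "least_per Z (Suc m) A'" "even (Suc m + A')"
    "other_per Z (Suc m) A' B'"
proof -
  have okA': "\<not> lt_at (m - A) (Z m) (Z (m - A))"
    using okA A by (auto simp: lt_at_def least_per_def)
  have Bl: "least_per Z m B" "odd (m + B)" if "B \<noteq> 0"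
    using B A that by (auto simp: other_per_def)
  have okB': "\<not> lt_at (m - B) (Z m) (Z (m - B))" if "B \<noteq> 0"
    using okB[OF that] Bl[OF that] by (auto simp: lt_at_def least_per_def)
  have noB: "\<not> per Z i m" if "B = 0" "0 < i" "i \<le> m" "odd (m + i)" for i
    using B A that by (auto simp: other_per_def)
  show "pregalois Z (Suc m)"
    unfolding pregalois_def
  proof (intro allI impI)
    fix i t assume it: "0 < i \<and> i \<le> t \<and> t < Suc m \<and> per Z i t"
    show "\<not> lt_at (t - i) (Z t) (Z (t - i))"
    proof (cases "t = m")
      case False
      then show ?thesis using pg it by (auto simp: pregalois_def)
    next
      case True
      show ?thesis
      proof (cases "even (m + i)")
        case True
        then show ?thesis
          using least_per_next(1)[OF pg A(1) okA', of i] it \<open>t = m\<close> A(2) by auto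
      next
        case False
        then have "B \<noteq> 0" using noB it True by auto
        then show ?thesis
          using least_per_next(1)[OF pg Bl(1) okB', of i] it \<open>t = m\<close> Bl(2) False by auto
      qed
    qed
  qed
  have keep: "least_per Z (Suc m) p" if "least_per Z m p" "Z m = Z (m - p)" for p
    using that by (auto simp: least_per_def per_Suc)
  have deadA: "\<not> per Z i (Suc m)" if "0 < i" "i \<le> m" "even (m + i)" "Z m \<noteq> Z (m - A)" for i
    using least_per_next(2)[OF pg A(1) okA', of i] that A(2) by (auto simp: per_Suc)
  have deadB: "\<not> per Z i (Suc m)"
    if "0 < i" "i \<le> m" "odd (m + i)" "B = 0 \<or> Z m \<noteq> Z (m - B)" for i
    using least_per_next(2)[OF pg Bl(1) okB', of i] that Bl(2) noB by (auto simp: per_Suc)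
  show A': "least_per Z (Suc m) A'" "even (Suc m + A')"
  proof -
    have "least_per Z (Suc m) A' \<and> even (Suc m + A')"
    proof (cases "B = 0 \<or> Z m < Z (m - B)")
      case True
      then show ?thesis using deadB by (force simp: A'_def least_per_def per_trivial)
    next
      case False
      then show ?thesis using keep[OF Bl(1)] okB Bl(2) by (auto simp: A'_def)
    qed
    then show "least_per Z (Suc m) A'" "even (Suc m + A')" by auto
  qed
  show "other_per Z (Suc m) A' B'"
  proof (cases "Z m = Z (m - A)")
    case True
    then show ?thesis
      using keep[OF A(1)] A A'(2) by (auto simp: B'_def other_per_def least_per_def)
  next
    case False
    have "\<not> per Z i (Suc m)" if "0 < i" "i \<le> Suc m" "odd (i + A')" for i
      using deadA[of i] that A'(2) False by (cases "i = Suc m") auto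
    then show ?thesis using False by (auto simp: B'_def other_per_def)
  qed
qed

section \<open>Prefixes that are Galois words\<close>

lemma shift_omega:
  assumes "k < h"
  shows "shift (h - k) (shift k (omega h Z)) = omega h Z"
proof -
  have "i + (h - k) + k = i + h" for i using assms by simp
  then show ?thesis by (simp add: shift_def omega_def)
qed

text \<open>A rotation by a non-period is larger by \<open>pregalois\<close>. If \<open>i\<close> is
  a period, \<open>h - i\<close> is odd and not a period, so the rotation by \<open>h - i\<close> is
  larger. Writing the word itself as its rotation by \<open>i\<close> and then by
  \<open>h - i\<close>, the common prefix of odd length \<open>h - i\<close> reverses this into the
  claim for \<open>i\<close>.\<close>

lemma galois_seqI:
  assumes pg: "pregalois Z h" and "0 < h"
    and no: "\<And>i. 0 < i \<Longrightarrow> i < h \<Longrightarrow> even (i + h) \<Longrightarrow> \<not> per Z i h"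
    and sq: "\<And>i. h = 2 * i \<Longrightarrow> \<not> per Z i h"
  shows "galois_seq Z h"
proof -
  let ?G = "omega h Z"
  have nonper: "seq_less ?G (shift i ?G)" if "0 < i" "i < h" "\<not> per Z i h" for i
  proof -
    obtain t where t: "i \<le> t" "t < h" "per Z i t" "Z t \<noteq> Z (t - i)"
      using \<open>\<not> per Z i h\<close> by (rule not_per_obtain)
    show ?thesis
    proof (rule seq_lessI[of "t - i"])
      show "?G j = shift i ?G j" if "j < t - i" for j
        using that t by (auto simp: omega_def shift_def per_def)
      show "lt_at (t - i) (?G (t - i)) (shift i ?G (t - i))"
        using pregalois_mismatch[OF pg _ t(1,2,3,4)] t \<open>0 < i\<close> by (auto simp: omega_def shift_def)
    qed
  qed
  have "seq_less ?G (shift i ?G)" if i: "0 < i" "i < h" for i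
  proof (cases "per Z i h")
    case True
    then have odd: "odd (h - i)" using no[OF i] i by auto
    \<comment> \<open>Two odd periods \<open>i\<close> and \<open>h - i\<close> make
      \<open>h\<close> even; doubling the shorter one gives an even period below \<open>h\<close>,
      against \<open>no\<close>, or \<open>h\<close> itself, against \<open>sq\<close>.\<close>
    have "\<not> per Z (h - i) h"
    proof
      assume per': "per Z (h - i) h"
      then have "odd i" using no[of "h - i"] i by auto
      then have ev: "even h" using odd i by auto
      consider "2 * i < h" | "2 * i = h" | "2 * (h - i) < h" using i by linarith
      then show False
      proof cases
        case 1 then show False using no[of "2 * i"] per_add[OF True True] ev i by (simp add: mult_2)
      next
        case 2 then show False using sq[of i] True by simp
      next
        case 3 then show False
          using no[of "2 * (h - i)"] per_add[OF per' per'] ev i by (simp add: mult_2)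
      qed
    qed
    then have "seq_less ?G (shift (h - i) ?G)" using nonper[of "h - i"] i by auto
    then have "seq_less (shift (h - i) (shift i ?G)) (shift (h - i) ?G)"
      using shift_omega[OF i(2), of Z] by simp
    then show ?thesis
    proof (rule seq_less_odd_prefix[rotated 2])
      show "shift i ?G j = ?G j" if "j < h - i" for j
        using that True i by (auto simp: omega_def shift_def per_def)
    qed (rule odd)
  qed (use nonper that in blast)
  then show ?thesis using \<open>0 < h\<close> by (simp add: galois_seq_def)
qed

text \<open>
  A prefix whose length is a shortest period of its parity is Galois, unless it is the square of
  a word of odd length.
\<close>

lemma least_per_galois:
  assumes pg: "pregalois Z m" and q: "least_per Z m q" and p: "other_per Z m q p"
  defines "h \<equiv> if q = 2 * p then p else q"
  shows "galois_seq Z h" "least_per Z m h"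
proof -
  have "p \<noteq> 0" if "q = 2 * p" using that q by (auto simp: least_per_def)
  then show h: "least_per Z m h"
    using p q by (auto simp: h_def other_per_def split: if_splits)
  show "galois_seq Z h"
  proof (rule galois_seqI)
    show "pregalois Z h" "0 < h" using h pg pregalois_mono by (auto simp: least_per_def)
    show no: "\<not> per Z i h" if "0 < i" "i < h" "even (i + h)" for i
      using period_persists[OF pg that(1,2) _ that(3)] h that by (auto simp: least_per_def)
    show "\<not> per Z i h" if i: "h = 2 * i" for i
    proof
      assume per: "per Z i h"
      have "0 < i" using i \<open>0 < h\<close> by auto
      then have "odd i" using no[of i] i per by auto
      \<comment> \<open>Otherwise \<open>h = p\<close> and \<open>q = 2 * p\<close>, so
        \<open>other_per\<close> makes \<open>h\<close> odd, against
        \<open>h = 2 * i\<close>.\<close>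
      have hq: "h = q"
        using p q i by (auto simp: h_def other_per_def split: if_splits)
      have "per Z i m"
      proof (rule ccontr)
        assume "\<not> per Z i m"
        then obtain t where t: "i \<le> t" "t < m" "per Z i t" "Z t \<noteq> Z (t - i)"
          by (rule not_per_obtain)
        have "h \<le> t" using t per by (auto simp: per_def not_le)
        then have "Z t = Z (t - h)" using h t by (auto simp: least_per_def per_def)
        also have "\<dots> = Z (t - i - i)" using i by (simp add: mult_2)
        also have "\<dots> = Z (t - i)" using t(3) \<open>h \<le> t\<close> i \<open>0 < i\<close> by (auto simp: per_def)
        finally show False using t(4) by simp
      qed
      moreover have "i \<le> m" using h i by (auto simp: least_per_def)
      ultimately have p0: "p \<noteq> 0" "least_per Z m p" "odd p"
        using p i hq \<open>odd i\<close> \<open>0 < i\<close> by (auto simp: other_per_def split: if_splits)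
      have "p \<le> i"
        using p0 \<open>per Z i m\<close> \<open>0 < i\<close> \<open>odd i\<close> by (auto simp: least_per_def not_less[symmetric])
      \<comment> \<open>Otherwise \<open>2 * p\<close> is a period below \<open>q = 2 * i\<close> of
        the same parity.\<close>
      moreover have "\<not> p < i"
        using q i hq per_add[of Z p m p] p0 by (auto simp: least_per_def mult_2)
      ultimately have "q = 2 * p" using hq i by auto
      then show False using hq p0 by (auto simp: h_def)
    qed
  qed
qed

section \<open>The remaining text and the next factor\<close>

lemma galois_seq_min:
  assumes "galois_seq Z h"
  shows "\<not> seq_less (shift k (omega h Z)) (omega h Z)"
proof -
  let ?G = "omega h Z"
  have mod: "shift k ?G = shift (k mod h) ?G"
    by (simp add: shift_def omega_def mod_simps)
  show ?thesis
  proof (cases "k mod h = 0")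
    case True
    then have "shift k ?G = ?G" unfolding mod by (simp add: shift_def)
    then show ?thesis using seq_less_asym by metis
  next
    case False
    then have "seq_less ?G (shift (k mod h) ?G)"
      using assms by (auto simp: galois_seq_def)
    then show ?thesis using mod seq_less_asym by metis
  qed
qed

text \<open>The rest after \<open>j\<close> copies follows the infinite power up to position
  \<open>m\<close>. There the power continues with \<open>Z (m - q)\<close> since \<open>h\<close>
  divides \<open>q\<close>, so the violation decides; \<open>j * h\<close> has the parity of
  \<open>q\<close>, which makes the directions agree.\<close>

lemma rest_less:
  assumes q: "least_per Z m q" and h: "least_per Z m h" "h dvd q"
    and viol: "lt_at (m - q) (Z m) (Z (m - q))"
    and j: "j * h \<le> m" "even (j * h + q)"
  shows "seq_less (shift (j * h) Z) (omega h Z)"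
proof (rule seq_lessI[of "m - j * h"])
  have per: "Z (x mod h) = Z x" if "x < m" for x
    using per_mod[of Z h m x] h that by (auto simp: least_per_def)
  show "shift (j * h) Z i = omega h Z i" if "i < m - j * h" for i
    using per[of "i + j * h"] that by (auto simp: shift_def omega_def)
  have "q \<le> m" "0 < q" using q by (auto simp: least_per_def)
  have "(m - j * h) mod h = m mod h"
    using j(1) by (metis le_add_diff_inverse2 mod_mult_self1 mult.commute)
  also have "\<dots> = (m - q) mod h"
    using h(2) \<open>q \<le> m\<close> by (metis dvd_def le_add_diff_inverse2 mod_mult_self2)
  finally have "Z ((m - j * h) mod h) = Z (m - q)"
    using per[of "m - q"] \<open>q \<le> m\<close> \<open>0 < q\<close> by simp
  moreover have "lt_at (m - j * h) = (lt_at (m - q) :: 'a \<Rightarrow> _)"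
    using lt_at_parity[of "m - j * h" "m - q"] j \<open>q \<le> m\<close> by fastforce
  ultimately show "lt_at (m - j * h) (shift (j * h) Z (m - j * h)) (omega h Z (m - j * h))"
    using viol j by (auto simp: shift_def omega_def)
qed

text \<open>For even \<open>q\<close> the repeated prefix is that of length \<open>q\<close>,
  possibly the square of an odd factor. For odd \<open>q\<close> the violation itself says that
  \<open>shift q Z\<close> is below \<open>Z\<close>, as \<open>next_le_odd\<close> asks.\<close>

lemma factor_le:
  assumes q: "least_per Z m q" and h: "least_per Z m h" "h dvd q"
    and viol: "lt_at (m - q) (Z m) (Z (m - q))"
    and min: "\<And>k. \<not> seq_less (shift k Y) Y" and less: "seq_less Z Y" and oq: "odd q \<Longrightarrow> h = q"
  shows "\<not> seq_less Y (omega h Z)"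
proof -
  have q': "0 < q" "q \<le> m" "per Z q m" using q by (auto simp: least_per_def)
  have Z: "Z i = omega h Z i" if "i < q" for i
    using per_mod[of Z h m i] h that q' by (auto simp: least_per_def omega_def)
  show ?thesis
  proof (cases "even q")
    case True
    have "omega h Z (i + q) = omega h Z i" for i
      using h(2) by (auto simp: omega_def elim!: dvdE)
    then show ?thesis using next_le_even[OF min less True] q' Z by blast
  next
    case False
    have "seq_less (shift q Z) Z"
    proof (rule seq_lessI[of "m - q"])
      show "shift q Z i = Z i" if "i < m - q" for i
        using q' that by (auto simp: shift_def per_def)
      show "lt_at (m - q) (shift q Z (m - q)) (Z (m - q))"
        using viol q' by (auto simp: shift_def)
    qed
    then show ?thesis using next_le_odd[OF min less False] Z by blast
  qed
qed

section \<open>Transfer to lists\<close>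

definition text_seq :: "'a list \<Rightarrow> nat \<Rightarrow> 'a option" where
  "text_seq T i = (if i < length T then Some (T ! i) else None)"

lemma alt_less_seq:
  "alt_less S T \<longleftrightarrow> seq_less (Some \<circ> inf_power S) (Some \<circ> inf_power T)"
  by (auto simp: alt_less_def seq_less_def lt_at_def)

lemma alt_le_seq:
  "alt_le S T \<longleftrightarrow> \<not> seq_less (Some \<circ> inf_power T) (Some \<circ> inf_power S)"
proof -
  have "alt_eq S T \<longleftrightarrow> Some \<circ> inf_power S = Some \<circ> inf_power T"
    by (auto simp: alt_eq_def fun_eq_iff)
  then show ?thesis
    unfolding alt_le_def alt_less_seq using seq_less_total seq_less_asym by metis
qed

lemma omega_text_seq:
  assumes "0 < h" "s + h \<le> length T"
  shows "omega h (shift s (text_seq T)) = Some \<circ> inf_power (take h (drop s T))"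
proof
  fix i
  have "i mod h < h" using assms(1) by simp
  then show "omega h (shift s (text_seq T)) i = (Some \<circ> inf_power (take h (drop s T))) i"
    using assms \<open>i mod h < h\<close>
    by (simp add: omega_def shift_def text_seq_def inf_power_def add.commute)
qed

lemma inf_power_rotate: "G \<noteq> [] \<Longrightarrow> inf_power (rotate k G) = shift k (inf_power G)"
  by (auto simp: fun_eq_iff inf_power_def shift_def nth_rotate mod_simps add.commute)

lemma galois_take:
  assumes "galois_seq (shift s (text_seq T)) h" "s + h \<le> length T"
  shows "galois (take h (drop s T))"
proof -
  let ?G = "take h (drop s T)"
  have h: "0 < h" "length ?G = h" using assms by (auto simp: galois_seq_def)
  then have "?G \<noteq> []" by auto
  moreover have "shift k (Some \<circ> inf_power ?G) = Some \<circ> inf_power (rotate k ?G)" for k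
    unfolding inf_power_rotate[OF \<open>?G \<noteq> []\<close>] by (simp add: shift_def comp_def)
  ultimately show ?thesis
    using assms(1) h omega_text_seq[OF h(1) assms(2)]
    by (auto simp: galois_def galois_seq_def alt_less_seq)
qed

lemma take_periodic:
  assumes "\<And>x. x < j * h \<Longrightarrow> xs ! (x mod h) = xs ! x" "j * h \<le> length xs"
  shows "take (j * h) xs = concat (replicate j (take h xs))"
  using assms
proof (induction j)
  case (Suc j)
  have "take h (drop (j * h) xs) = take h xs"
  proof (rule nth_equalityI)
    fix i assume "i < length (take h (drop (j * h) xs))"
    then have i: "i < h" by simp
    then show "take h (drop (j * h) xs) ! i = take h xs ! i"
      using Suc.prems(1)[of "j * h + i"] Suc.prems(2) by simp
  qed (use Suc.prems in auto)
  moreover have "take (j * h) xs = concat (replicate j (take h xs))"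
    using Suc by simp
  ultimately show ?case
    by (simp add: take_add add.commute[of h] flip: replicate_append_same)
qed simp

text \<open>The strict inequality for the whole remaining text is the part of the invariant that
  keeps the next factor from exceeding the last one.\<close>

definition partial_factorization :: "'a::linorder list \<Rightarrow> nat \<Rightarrow> 'a list list \<Rightarrow> bool" where
  "partial_factorization T s Gs \<longleftrightarrow>
     s \<le> length T \<and> galois_factorization (take s T) Gs \<and>
     (Gs \<noteq> [] \<longrightarrow> seq_less (shift s (text_seq T)) (Some \<circ> inf_power (last Gs)))"

lemma successively_replicate: "P x x \<Longrightarrow> successively P (replicate j x)"
proof (induction j)
  case (Suc j)
  then show ?case by (cases j) auto
qed simp

lemma partial_factorization_step:
  fixes T :: "'a::linorder list"
  defines "Z \<equiv> \<lambda>s. shift s (text_seq T)"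
  assumes part: "partial_factorization T s Gs" and "s + m \<le> length T"
    and pg: "pregalois (Z s) m" and q: "least_per (Z s) m q" and p: "other_per (Z s) m q p"
    and viol: "lt_at (m - q) (Z s m) (Z s (m - q))"
    and h: "h = (if q = 2 * p then p else q)"
    and j: "0 < j" "j * h \<le> m" "even (j * h + q)"
  shows "partial_factorization T (s + j * h) (Gs @ replicate j (take h (drop s T)))"
proof -
  let ?G = "take h (drop s T)"
  note hG = least_per_galois[OF pg q p, folded h]
  have h': "0 < h" "h \<le> m" "per (Z s) h m" using hG(2) by (auto simp: least_per_def)
  have dvd: "h dvd q" using h by auto
  have sh: "s + h \<le> length T" using h' assms(3) by simp
  have G: "omega h (Z s) = Some \<circ> inf_power ?G"
    unfolding Z_def by (rule omega_text_seq[OF h'(1) sh])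
  have "galois ?G" using hG(1) sh unfolding Z_def by (intro galois_take)
  have rest: "seq_less (Z (s + j * h)) (Some \<circ> inf_power ?G)"
  proof -
    have "Z (s + j * h) = shift (j * h) (Z s)"
      by (simp add: Z_def shift_def fun_eq_iff ac_simps)
    then show ?thesis using rest_less[OF q hG(2) dvd viol j(2,3)] G by simp
  qed
  have le: "alt_le ?G (last Gs)" if "Gs \<noteq> []"
  proof -
    have less: "seq_less (Z s) (Some \<circ> inf_power (last Gs))"
      using part that by (auto simp: partial_factorization_def Z_def)
    have "galois (last Gs)"
      using part that by (auto simp: partial_factorization_def galois_factorization_def)
    then have min: "\<not> seq_less (shift k (Some \<circ> inf_power (last Gs))) (Some \<circ> inf_power (last Gs))"
      for k
    proof -
      let ?L = "last Gs"
      have L: "0 < length ?L" using \<open>galois ?L\<close> by (auto simp: galois_def)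
      \<comment> \<open>The last factor is viewed as a text of its own, which makes
        \<open>galois_seq_min\<close> applicable.\<close>
      have "omega (length ?L) (text_seq ?L) = Some \<circ> inf_power ?L"
        using omega_text_seq[OF L, of 0 ?L] by (simp add: shift_def)
      moreover have "shift k (Some \<circ> inf_power ?L) = Some \<circ> inf_power (rotate k ?L)" for k
        using L inf_power_rotate[of ?L k] by (simp add: shift_def comp_def)
      ultimately have "galois_seq (text_seq ?L) (length ?L)"
        using \<open>galois ?L\<close> by (auto simp: galois_seq_def galois_def alt_less_seq)
      then show ?thesis
        using galois_seq_min \<open>omega (length ?L) (text_seq ?L) = _\<close> by metis
    qed
    have "odd q \<Longrightarrow> h = q" using h by auto
    from factor_le[OF q hG(2) dvd viol min less this] show ?thesis
      unfolding G alt_le_seq by simp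
  qed
  have "take (j * h) (drop s T) = concat (replicate j ?G)"
  proof (rule take_periodic)
    fix x assume x: "x < j * h"
    then have "x < m" using j by simp
    then have "Z s (x mod h) = Z s x" using per_mod[OF h'(3,1)] by simp
    moreover have "x mod h \<le> x" by simp
    ultimately show "drop s T ! (x mod h) = drop s T ! x"
      using \<open>x < m\<close> assms(3) by (simp add: Z_def shift_def text_seq_def add.commute)
  qed (use j assms(3) in simp)
  then have concat: "concat (Gs @ replicate j ?G) = take (s + j * h) T"
    using part by (simp add: partial_factorization_def galois_factorization_def take_add)
  have refl: "alt_le ?G ?G" by (simp add: alt_le_def alt_eq_def)
  have "successively (\<lambda>G H. alt_le H G) (Gs @ replicate j ?G)"
    using part le j(1) successively_replicate[where P = "\<lambda>G H. alt_le H G", OF refl, of j]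
    by (auto simp: partial_factorization_def galois_factorization_def successively_append_iff
        hd_replicate)
  then show ?thesis
    using concat part \<open>galois ?G\<close> rest j assms(3)
    by (auto simp: partial_factorization_def galois_factorization_def Z_def)
qed


section \<open>The program\<close>

text \<open>
  Register 1 holds the start of the rest of the text and register 2 the position of the next
  symbol.  While scanning, registers 3 and 4 hold the shortest periods of the scanned prefix
  whose parity is that of its length and the other one, respectively; 0 in register 4 means that
  there is none.  On a violation, register 3 holds the violated period, and register 4 then
  receives the length of the factors to output.  Registers 5 and 6 hold the constants 1 and 0.
\<close>

definition galois_prog :: program where
  "galois_prog =
    [Const 5 1,
     \<comment> \<open>1: start of a round\<close>
     JumpEq 1 0 44,
     Op Add 2 1 5,
     Const 3 1,
     Const 4 0,
     \<comment> \<open>5: scan the next symbol\<close>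
     JumpEq 2 0 26,
     Op Sub 7 2 3,
     JumpSymLess 2 7 26,
     Move 8 6,
     JumpSymEq 2 7 11,
     Jump 12,
     Move 8 3,
     \<comment> \<open>12\<close>
     Op Sub 9 2 1,
     Op Add 9 9 5,
     JumpEq 4 6 19,
     Op Sub 7 2 4,
     JumpSymLess 7 2 23,
     JumpSymLess 2 7 19,
     Move 9 4,
     \<comment> \<open>19: the length changes parity, so the two periods change places\<close>
     Move 3 9,
     Move 4 8,
     Op Add 2 2 5,
     Jump 5,
     \<comment> \<open>23: violation by the period in register 4\<close>
     Move 7 3,
     Move 3 4,
     Move 4 7,
     \<comment> \<open>26: violation by the period in register 3\<close>
     Op Add 1 1 3,
     JumpLess 4 3 29,
     Jump 31,
     Op Sub 7 3 4,
     JumpEq 7 4 33,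
     \<comment> \<open>31\<close>
     Move 4 3,
     Jump 34,
     \<comment> \<open>33: square, two factors\<close>
     Emit 4,
     Emit 4,
     \<comment> \<open>35: output further factors in pairs, which preserves the parity of the rest\<close>
     Op Sub 7 2 1,
     JumpLess 7 4 1,
     Op Sub 7 7 4,
     JumpLess 7 4 1,
     Emit 4,
     Emit 4,
     Op Add 1 1 4,
     Op Add 1 1 4,
     Jump 35,
     \<comment> \<open>44\<close>
     Halt]"

lemma length_prog: "length galois_prog = 45"
  by (simp add: galois_prog_def)

section \<open>Symbolic execution and step counting\<close>

lemma run_numeral:
  "run w T p (numeral k) c = Option.bind (step w T p c) (run w T p (pred_numeral k))"
  by (simp add: numeral_eq_Suc)

lemma run_add:
  "run w T p (s + t) c = Option.bind (run w T p s c) (run w T p t)"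
  by (induction s arbitrary: c) (auto split: Option.bind_split)

lemma eval_add: "x + y < 2 ^ w \<Longrightarrow> eval_binop w Add x y = x + y"
  by (simp add: take_bit_nat_eq_self)

lemma eval_sub:
  assumes "y \<le> x" "x < 2 ^ w"
  shows "eval_binop w Sub x y = x - y"
proof -
  have "int x - int y = int (x - y)" using assms(1) by simp
  moreover have "x - y < 2 ^ w" using assms by simp
  ultimately show ?thesis
    by (simp add: take_bit_nat_eq_self take_bit_of_nat del: of_nat_diff)
qed

text \<open>Registers 7 to 9 are scratch and left open. The clause \<open>touched c = {}\<close>
  carries the space bound: the memory is never accessed.\<close>

definition at_state ::
  "nat \<Rightarrow> nat \<Rightarrow> nat \<Rightarrow> nat \<Rightarrow> nat \<Rightarrow> nat \<Rightarrow> nat list \<Rightarrow> config \<Rightarrow> bool" where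
  "at_state l n s i a b os c \<longleftrightarrow>
     pc c = l \<and> reg c 0 = n \<and> reg c 1 = s \<and> reg c 2 = i \<and> reg c 3 = a \<and> reg c 4 = b \<and>
     reg c 5 = Suc 0 \<and> reg c 6 = 0 \<and> touched c = {} \<and> out c = os"

definition reaches ::
  "nat \<Rightarrow> 'a::linorder list \<Rightarrow> nat \<Rightarrow> config \<Rightarrow> (config \<Rightarrow> bool) \<Rightarrow> bool" where
  "reaches w T t c P \<longleftrightarrow> (\<exists>t'\<le>t. \<exists>c'. run w T galois_prog t' c = Some c' \<and> P c')"

lemma reachesI:
  "run w T galois_prog t' c = Some c' \<Longrightarrow> P c' \<Longrightarrow> t' \<le> t \<Longrightarrow> reaches w T t c P"
  by (auto simp: reaches_def)

lemma reachesE: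
  assumes "reaches w T t c P"
  obtains t' c' where "run w T galois_prog t' c = Some c'" "P c'" "t' \<le> t"
  using assms by (auto simp: reaches_def)

lemma reaches_after:
  assumes "run w T galois_prog t c = Some c'" "reaches w T u c' P" "t + u \<le> v"
  shows "reaches w T v c P"
proof -
  obtain t' c'' where "run w T galois_prog t' c' = Some c''" "P c''" "t' \<le> u"
    using assms(2) by (rule reachesE)
  then show ?thesis
    using assms(1,3) by (intro reachesI[where t' = "t + t'" and c' = c'']) (auto simp: run_add)
qed

text \<open>A nonempty text forces \<open>0 < w\<close>, so that the constant 1 in register 5 is not
  truncated to 0.\<close>

locale galois_ram =
  fixes T :: "'a::linorder list" and w :: nat
  assumes word: "length T < 2 ^ w" and nonempty: "T \<noteq> []"
begin

abbreviation "n \<equiv> length T"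

lemma small: "x \<le> n \<Longrightarrow> x < 2 ^ w"
  using word by simp

lemma word_pos: "0 < w"
  using word nonempty by (cases w) auto

lemmas exec_simps = run_numeral step_def set_reg_def branch_def length_prog galois_prog_def
  eval_add eval_sub small word_pos less_imp_diff_less

lemma exec_start:
  assumes "at_state 1 n s i a b os c" "s < n"
  shows "reaches w T 4 c (at_state 5 n s (Suc s) 1 0 os)"
  by - (rule reachesI[where t' = 4], insert assms(1)[unfolded at_state_def] assms(2-),
    (simp add: exec_simps at_state_def del: eval_binop.simps)+)

lemma exec_finish:
  assumes "at_state 1 n n i a b os c"
  shows "reaches w T 1 c (at_state 44 n n i a b os)"
  by - (rule reachesI[where t' = 1], insert assms(1)[unfolded at_state_def],
    (simp add: exec_simps at_state_def del: eval_binop.simps)+)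

lemma exec_scan_end:
  assumes "at_state 5 n s n a b os c"
  shows "reaches w T 14 c (at_state 26 n s n a b os)"
  by - (rule reachesI[where t' = 1], insert assms(1)[unfolded at_state_def],
    (simp add: exec_simps at_state_def del: eval_binop.simps)+)

lemma exec_scan_violA:
  assumes "at_state 5 n s i a b os c" "i < n" "a \<le> i" "T ! i < T ! (i - a)"
  shows "reaches w T 14 c (at_state 26 n s i a b os)"
  by - (rule reachesI[where t' = 3], insert assms(1)[unfolded at_state_def] assms(2-),
    (simp add: exec_simps at_state_def del: eval_binop.simps)+)

lemma exec_scan_violB:
  assumes "at_state 5 n s i a b os c" "i < n" "s \<le> i" "a \<le> i" "\<not> T ! i < T ! (i - a)"
    "0 < b" "b \<le> i" "T ! (i - b) < T ! i"
  shows "reaches w T 14 c (at_state 26 n s i b a os)"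
proof (cases "T ! i = T ! (i - a)")
  case True
  then show ?thesis
    by - (rule reachesI[where t' = 14], insert assms(1)[unfolded at_state_def] assms(2-)
        \<open>T ! i = T ! (i - a)\<close>,
      (simp add: exec_simps at_state_def del: eval_binop.simps)+)
next
  case False
  then show ?thesis
    by - (rule reachesI[where t' = 14], insert assms(1)[unfolded at_state_def] assms(2-)
        \<open>T ! i \<noteq> T ! (i - a)\<close>,
      (simp add: exec_simps at_state_def del: eval_binop.simps)+)
qed

text \<open>The new register values are \<open>A'\<close> and \<open>B'\<close> of
  \<open>pregalois_step\<close> with \<open>m = i - s\<close>.\<close>

lemma exec_scan_step:
  assumes "at_state 5 n s i a b os c" "i < n" "s \<le> i" "a \<le> i" "\<not> T ! i < T ! (i - a)"
    "b \<le> i" "b \<noteq> 0 \<Longrightarrow> \<not> T ! (i - b) < T ! i"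
  defines "a' \<equiv> if b = 0 \<or> T ! i < T ! (i - b) then Suc (i - s) else b"
    and "b' \<equiv> if T ! i = T ! (i - a) then a else 0"
  shows "reaches w T 17 c (at_state 5 n s (Suc i) a' b' os)"
proof -
  have eq: "T ! i = T ! (i - b)" if "b \<noteq> 0" "\<not> T ! i < T ! (i - b)"
    using assms(7) that by auto
  consider "b = 0" | "0 < b" "T ! i < T ! (i - b)" | "0 < b" "T ! i = T ! (i - b)"
    using eq by auto
  then show ?thesis
  proof cases
    case 1
    then show ?thesis
      by - (cases "T ! i = T ! (i - a)"; (rule reachesI[where t' = 13],
        insert assms(1)[unfolded at_state_def] assms(2-),
        (simp add: exec_simps at_state_def del: eval_binop.simps)+))
  next
    case 2
    then show ?thesis
      by - (cases "T ! i = T ! (i - a)"; (rule reachesI[where t' = 16],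
        insert assms(1)[unfolded at_state_def] assms(2-),
        (simp add: exec_simps at_state_def del: eval_binop.simps)+))
  next
    case 3
    then show ?thesis
      by - (cases "T ! i = T ! (i - a)"; (rule reachesI[where t' = 17],
        insert assms(1)[unfolded at_state_def] assms(2-),
        (simp add: exec_simps at_state_def del: eval_binop.simps)+))
  qed
qed

text \<open>The program tests for a square by comparing \<open>q - p\<close> with \<open>p\<close>,
  after checking \<open>p < q\<close>; thus no intermediate result wraps around.\<close>

lemma exec_viol:
  assumes "at_state 26 n s i q p os c" "s + q \<le> n" "q \<noteq> 0"
  defines "h \<equiv> if q = 2 * p then p else q"
  shows "reaches w T 7 c
    (at_state 35 n (s + q) i q h (os @ (if q = 2 * p then [h, h] else [h])))"
proof -
  consider "q = 2 * p" "p < q" | "q \<noteq> 2 * p" "p < q" | "q \<noteq> 2 * p" "\<not> p < q"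
    using assms(3) by fastforce
  then show ?thesis
  proof cases
    case 1
    then have "q - p = p" by simp
    then show ?thesis using 1
      by - (rule reachesI[where t' = 6], insert assms(1)[unfolded at_state_def] assms(2-),
        (simp add: exec_simps at_state_def del: eval_binop.simps)+)
  next
    case 2
    then have "q - p \<noteq> p" by auto
    then show ?thesis using 2
      by - (rule reachesI[where t' = 7], insert assms(1)[unfolded at_state_def] assms(2-),
        (simp add: exec_simps at_state_def del: eval_binop.simps)+)
  next
    case 3
    then show ?thesis
      by - (rule reachesI[where t' = 6], insert assms(1)[unfolded at_state_def] assms(2-),
        (simp add: exec_simps at_state_def del: eval_binop.simps)+)
  qed
qed

lemma exec_emit_step:
  assumes "at_state 35 n s i q h os c" "i \<le> n" "s + 2 * h \<le> i"
  shows "reaches w T 9 c (at_state 35 n (s + 2 * h) i q h (os @ [h, h]))"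
proof -
  have "s \<le> i" "\<not> i - s < h" "h \<le> i - s" "\<not> i - s - h < h" "i - s \<le> n" "s + h \<le> n"
    "s + h + h \<le> n" "s + 2 * h = s + h + h"
    using assms by auto
  then show ?thesis
    by - (rule reachesI[where t' = 9], insert assms(1)[unfolded at_state_def] assms(2),
        (simp add: exec_simps at_state_def del: eval_binop.simps diff_diff_left)+)
qed

lemma exec_emit_end:
  assumes "at_state 35 n s i q h os c" "s \<le> i" "i \<le> n" "i < s + 2 * h"
  shows "reaches w T 4 c (at_state 1 n s i q h os)"
proof (cases "i - s < h")
  case True
  then show ?thesis
    by - (rule reachesI[where t' = 2], insert assms(1)[unfolded at_state_def] assms(2-)
        \<open>i - s < h\<close>,
      (simp add: exec_simps at_state_def del: eval_binop.simps)+)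
next
  case False
  then show ?thesis
    by - (rule reachesI[where t' = 4], insert assms(1)[unfolded at_state_def] assms(2-)
        \<open>\<not> i - s < h\<close>,
      (simp add: exec_simps at_state_def del: eval_binop.simps)+)
qed


section \<open>The loops and the linear time bound\<close>

text \<open>Induction on the unscanned text: each accepted symbol costs at most 17 steps and keeps
  the invariant by \<open>pregalois_step\<close>; the exit costs at most 14.\<close>

lemma scan:
  fixes s m :: nat
  defines "Z \<equiv> shift s (text_seq T)"
  assumes "at_state 5 n s (s + m) a b os c" "s + m \<le> n"
    and "pregalois Z m" "least_per Z m a" "even (m + a)" "other_per Z m a b"
  shows "\<exists>m' q p. m \<le> m' \<and> s + m' \<le> n \<and> pregalois Z m' \<and> least_per Z m' q \<and>
    other_per Z m' q p \<and> lt_at (m' - q) (Z m') (Z (m' - q)) \<and>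
    reaches w T (17 * (m' - m) + 14) c (at_state 26 n s (s + m') q p os)"
  using assms(2-)
proof (induction "n - (s + m)" arbitrary: m a b c rule: less_induct)
  case less
  note prems = less.prems
  let ?i = "s + m"
  have a: "0 < a" "a \<le> m" using prems(4) by (auto simp: least_per_def)
  have b: "b \<le> m" "b \<noteq> 0 \<Longrightarrow> least_per Z m b \<and> odd (m + b)"
    using prems(4-6) by (auto simp: other_per_def least_per_def split: if_splits)
  have Z: "Z x = Some (T ! (s + x))" if "s + x < n" for x
    using that by (simp add: Z_def shift_def text_seq_def add.commute)
  have sub_index: "s + (m - x) = ?i - x" if "x \<le> m" for x using that by simp
  have sub: "Z (m - x) = Some (T ! (?i - x))" if "0 < x" "x \<le> m" for x
    using Z[of "m - x"] sub_index[of x] that prems(2) by simp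
  show ?case
  proof (cases "?i = n")
    case True
    \<comment> \<open>The endmarker lies below every symbol and \<open>m - a\<close> is even, so the
      end of the text counts as a violation by the period \<open>a\<close>.\<close>
    then have "Z m = None" by (simp add: Z_def shift_def text_seq_def add.commute)
    then have "lt_at (m - a) (Z m) (Z (m - a))"
      using sub[OF a] a prems(5) by (simp add: lt_at_def)
    moreover have "at_state 5 n s n a b os c" using prems(1) True by simp
    ultimately show ?thesis
      using exec_scan_end prems True by (intro exI[of _ m] exI[of _ a] exI[of _ b]) auto
  next
    case False
    then have i: "?i < n" using prems(2) by simp
    show ?thesis
    proof (cases "Z m < Z (m - a)")
      case True
      then have "lt_at (m - a) (Z m) (Z (m - a))" using a prems(5) by (simp add: lt_at_def)
      moreover have "T ! ?i < T ! (?i - a)" using True Z[OF i] sub[OF a] by simp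
      ultimately show ?thesis
        using exec_scan_violA[OF prems(1) i] a prems
        by (intro exI[of _ m] exI[of _ a] exI[of _ b]) auto
    next
      case okA: False
      then have okA': "\<not> T ! ?i < T ! (?i - a)" using Z[OF i] sub[OF a] by simp
      show ?thesis
      proof (cases "b \<noteq> 0 \<and> Z (m - b) < Z m")
        case True
        then have lb: "least_per Z m b" "odd (m + b)" "0 < b" using b by auto
        then have "lt_at (m - b) (Z m) (Z (m - b))" using True b(1) by (simp add: lt_at_def)
        moreover have "other_per Z m b a"
          using a prems(4,5) lb by (simp add: other_per_def)
        moreover have "T ! (?i - b) < T ! ?i"
          using True Z[OF i] sub[OF lb(3) b(1)] by simp
        ultimately show ?thesis
          using exec_scan_violB[OF prems(1) i _ _ okA'] a b(1) lb prems
          by (intro exI[of _ m] exI[of _ b] exI[of _ a]) auto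
      next
        case okB: False
        let ?a = "if b = 0 \<or> Z m < Z (m - b) then Suc m else b"
        let ?b = "if Z m = Z (m - a) then a else 0"
        have inv: "pregalois Z (Suc m)" "least_per Z (Suc m) ?a" "even (Suc m + ?a)"
          "other_per Z (Suc m) ?a ?b"
          using pregalois_step[OF prems(3-6)] okA okB by (auto simp: not_less)
        have "b \<noteq> 0 \<Longrightarrow> \<not> T ! (?i - b) < T ! ?i"
          using okB Z[OF i] sub[of b] b(1) by simp
        then have "reaches w T 17 c (at_state 5 n s (s + Suc m) ?a ?b os)"
          using exec_scan_step[OF prems(1) i _ _ okA'] a b(1) Z[OF i] sub[OF a] sub[of b]
          by (cases "b = 0") auto
        then obtain t c' where c': "run w T galois_prog t c = Some c'" "t \<le> 17"
          "at_state 5 n s (s + Suc m) ?a ?b os c'"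
          by (elim reachesE) auto
        have dec: "n - (s + Suc m) < n - (s + m)" and le: "s + Suc m \<le> n"
          using i by auto
        obtain m' q p where m': "Suc m \<le> m'" "s + m' \<le> n" "pregalois Z m'" "least_per Z m' q"
          "other_per Z m' q p" "lt_at (m' - q) (Z m') (Z (m' - q))"
          "reaches w T (17 * (m' - Suc m) + 14) c' (at_state 26 n s (s + m') q p os)"
          using less.hyps[OF dec c'(3) le inv] by blast
        have "reaches w T (17 * (m' - m) + 14) c (at_state 26 n s (s + m') q p os)"
          using m'(1) c'(2) by (intro reaches_after[OF c'(1) m'(7)]) auto
        then show ?thesis
          using m' by (intro exI[of _ m'] exI[of _ q] exI[of _ p]) auto
      qed
    qed
  qed
qed

text \<open>Less than \<open>2 * h\<close> scanned symbols remain at the end, which bounds what is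
  scanned again.\<close>

lemma emit_pairs:
  assumes "at_state 35 n s i q h os c" "s \<le> i" "i \<le> n" "0 < h"
  shows "\<exists>k. s + 2 * k * h \<le> i \<and> i < s + 2 * k * h + 2 * h \<and>
    reaches w T (9 * k + 4) c (at_state 1 n (s + 2 * k * h) i q h (os @ replicate (2 * k) h))"
  using assms
proof (induction "i - s" arbitrary: s os c rule: less_induct)
  case less
  show ?case
  proof (cases "i < s + 2 * h")
    case True
    then show ?thesis using exec_emit_end[OF less.prems(1-3)] less.prems(2)
      by (intro exI[of _ 0]) auto
  next
    case False
    then obtain t c' where c': "run w T galois_prog t c = Some c'" "t \<le> 9"
      "at_state 35 n (s + 2 * h) i q h (os @ [h, h]) c'"
      using exec_emit_step[OF less.prems(1,3)] by (auto elim!: reachesE)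
    have dec: "i - (s + 2 * h) < i - s" and le: "s + 2 * h \<le> i"
      using less.prems(4) False by auto
    obtain k where k: "s + 2 * h + 2 * k * h \<le> i" "i < s + 2 * h + 2 * k * h + 2 * h"
      "reaches w T (9 * k + 4) c'
        (at_state 1 n (s + 2 * h + 2 * k * h) i q h ((os @ [h, h]) @ replicate (2 * k) h))"
      using less.hyps[OF dec c'(3) le less.prems(3,4)] by blast
    have "reaches w T (9 * Suc k + 4) c
        (at_state 1 n (s + 2 * h + 2 * k * h) i q h ((os @ [h, h]) @ replicate (2 * k) h))"
      using c'(2) by (intro reaches_after[OF c'(1) k(3)]) auto
    then show ?thesis using k(1,2) by (intro exI[of _ "Suc k"]) (auto simp: algebra_simps)
  qed
qed

text \<open>The cost is charged to the text split off: the scanned length \<open>m\<close> is below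
  \<open>j * h + 2 * h\<close>, hence below three times the length \<open>j * h\<close>
  removed.\<close>

lemma split_off_factors:
  assumes c: "at_state 1 n s i a b (map length Gs) c" and "s < n"
    and part: "partial_factorization T s Gs"
  shows "\<exists>s' i' a' b' Gs'. s < s' \<and> partial_factorization T s' Gs' \<and>
    reaches w T (100 * (s' - s)) c (at_state 1 n s' i' a' b' (map length Gs'))"
proof -
  let ?Z = "shift s (text_seq T)"
  obtain t1 c1 where c1: "run w T galois_prog t1 c = Some c1" "t1 \<le> 4"
    "at_state 5 n s (s + 1) 1 0 (map length Gs) c1"
    using exec_start[OF c \<open>s < n\<close>] by (auto elim!: reachesE)
  \<comment> \<open>A single symbol has only the period 1, whose parity is that of the
    length.\<close>
  have "pregalois ?Z 1" "least_per ?Z 1 1" "other_per ?Z 1 1 0"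
    by (auto simp: pregalois_def least_per_def other_per_def per_def le_Suc_eq)
  then obtain m q p where m: "1 \<le> m" "s + m \<le> n" "pregalois ?Z m" "least_per ?Z m q"
    "other_per ?Z m q p" "lt_at (m - q) (?Z m) (?Z (m - q))"
    "reaches w T (17 * (m - 1) + 14) c1 (at_state 26 n s (s + m) q p (map length Gs))"
    using scan[OF c1(3)] \<open>s < n\<close> by auto
  obtain t2 c2 where c2: "run w T galois_prog t2 c1 = Some c2" "t2 \<le> 17 * (m - 1) + 14"
    "at_state 26 n s (s + m) q p (map length Gs) c2"
    using m(7) by (auto elim!: reachesE)
  define h where "h = (if q = 2 * p then p else q)"
  define e :: nat where "e = (if q = 2 * p then 2 else 1)"
  have q: "0 < q" "q \<le> m" using m(4) by (auto simp: least_per_def)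
  have h: "0 < h" "e * h = q" using q by (auto simp: h_def e_def)
  have "replicate e h = (if q = 2 * p then [h, h] else [h])"
    by (simp add: e_def numeral_2_eq_2)
  then obtain t3 c3 where c3: "run w T galois_prog t3 c2 = Some c3" "t3 \<le> 7"
    "at_state 35 n (s + q) (s + m) q h (map length Gs @ replicate e h) c3"
    using exec_viol[OF c2(3), folded h_def] q m(2) by (auto elim!: reachesE)
  obtain k where k: "s + q + 2 * k * h \<le> s + m" "s + m < s + q + 2 * k * h + 2 * h"
    "reaches w T (9 * k + 4) c3 (at_state 1 n (s + q + 2 * k * h) (s + m) q h
      ((map length Gs @ replicate e h) @ replicate (2 * k) h))"
    using emit_pairs[OF c3(3)] q m(2) h(1) by auto
  \<comment> \<open>The \<open>2 * k\<close> copies added to the first \<open>e\<close> keep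
    \<open>j * h\<close> in the parity of \<open>q\<close>, as \<open>rest_less\<close>
    requires.\<close>
  define j where "j = e + 2 * k"
  have jh: "j * h = q + 2 * k * h" using h(2) by (simp add: j_def algebra_simps)
  have "partial_factorization T (s + j * h) (Gs @ replicate j (take h (drop s T)))"
    by (rule partial_factorization_step[OF part m(2-6) h_def])
      (use jh k(1) in \<open>auto simp: j_def e_def\<close>)
  moreover have "h \<le> m" using h q by (cases e) auto
  then have "map length (replicate j (take h (drop s T))) = replicate j h"
    using m(2) by simp
  then have "map length Gs @ replicate j h = map length (Gs @ replicate j (take h (drop s T)))"
    by simp
  moreover have "reaches w T (100 * (j * h)) c
    (at_state 1 n (s + j * h) (s + m) q h (map length Gs @ replicate j h))"
  proof -
    have "1 \<le> j" "k \<le> j" by (auto simp: j_def e_def)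
    then have "h \<le> j * h" "k \<le> j * h" "0 < j * h"
      using h(1) mult_le_mono2[of 1 h j] by (auto intro: order_trans)
    then have "t1 + (t2 + (t3 + (9 * k + 4))) \<le> 100 * (j * h)"
      using c1(2) c2(2) c3(2) k(2) jh m(1) by linarith
    then show ?thesis
      using reaches_after[OF c1(1) reaches_after[OF c2(1) reaches_after[OF c3(1) k(3)
        order_refl] order_refl]]
      by (simp add: jh add.assoc flip: replicate_add j_def)
  qed
  moreover have "s < s + j * h" using q jh by simp
  moreover have "s + j * h - s = j * h" by simp
  ultimately show ?thesis by metis
qed

lemma all_rounds:
  assumes "at_state 1 n s i a b (map length Gs) c" "partial_factorization T s Gs"
  shows "\<exists>i' a' b' Gs'. galois_factorization T Gs' \<and>
    reaches w T (100 * (n - s) + 1) c (at_state 44 n n i' a' b' (map length Gs'))"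
  using assms
proof (induction "n - s" arbitrary: s i a b Gs c rule: less_induct)
  case less
  show ?case
  proof (cases "s = n")
    case True
    then have "galois_factorization T Gs"
      using less.prems(2) by (simp add: partial_factorization_def)
    then show ?thesis
      using exec_finish[of i a b "map length Gs" c] less.prems(1) True
      by (intro exI[of _ i] exI[of _ a] exI[of _ b] exI[of _ Gs]) simp
  next
    case False
    then have "s < n" using less.prems(2) by (simp add: partial_factorization_def)
    then obtain s' i' a' b' Gs' where s': "s < s'" "partial_factorization T s' Gs'"
      "reaches w T (100 * (s' - s)) c (at_state 1 n s' i' a' b' (map length Gs'))"
      using split_off_factors[OF less.prems(1) _ less.prems(2)] by auto
    obtain t c' where c': "run w T galois_prog t c = Some c'" "t \<le> 100 * (s' - s)"
      "at_state 1 n s' i' a' b' (map length Gs') c'"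
      using s'(3) by (auto elim!: reachesE)
    obtain i'' a'' b'' Gs'' where r: "galois_factorization T Gs''"
      "reaches w T (100 * (n - s') + 1) c' (at_state 44 n n i'' a'' b'' (map length Gs''))"
      using less.hyps[OF _ c'(3) s'(2)] diff_less_mono2[OF s'(1) \<open>s < n\<close>] by blast
    have "s' \<le> n" using s'(2) by (simp add: partial_factorization_def)
    then have "reaches w T (100 * (n - s) + 1) c (at_state 44 n n i'' a'' b'' (map length Gs''))"
      using c'(2) s'(1) by (intro reaches_after[OF c'(1) r(2)]) auto
    then show ?thesis using r(1) by blast
  qed
qed

end

lemma galois_prog_correct:
  fixes T :: "'a::linorder list"
  assumes "length T < 2 ^ w"
  shows "\<exists>t c Gs. halts_after w T galois_prog t c \<and> galois_factorization T Gs \<and>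
    out c = map length Gs \<and> t \<le> 100 * length T + 2 \<and> touched c = {}"
proof -
  have halt: "galois_prog ! 44 = Halt" by (simp add: galois_prog_def)
  have run1: "run w T galois_prog 1 (init_config T) =
      Some (set_reg 5 (take_bit w 1) (init_config T))"
    by (simp add: step_def galois_prog_def init_config_def)
  show ?thesis
  proof (cases "T = []")
    case True
    let ?c = "branch True 44 (set_reg 5 (take_bit w 1) (init_config T))"
    have "run w T galois_prog 2 (init_config T) = Some ?c"
      using True
      by (simp add: run_numeral step_def galois_prog_def init_config_def set_reg_def branch_def)
    then have "halts_after w T galois_prog 2 ?c"
      by (simp add: halts_after_def halt length_prog branch_def)
    moreover have "galois_factorization T []" using True by (simp add: galois_factorization_def)
    moreover have "out ?c = map length []" "touched ?c = {}"
      by (simp_all add: branch_def set_reg_def init_config_def)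
    ultimately show ?thesis by fastforce
  next
    case False
    then interpret galois_ram T w using assms by unfold_locales
    have "at_state 1 n 0 0 0 0 (map length []) (set_reg 5 (take_bit w 1) (init_config T))"
      by (simp add: at_state_def set_reg_def init_config_def word_pos)
    moreover have "partial_factorization T 0 []"
      by (simp add: partial_factorization_def galois_factorization_def)
    ultimately obtain i a b Gs where Gs: "galois_factorization T Gs"
      "reaches w T (100 * (n - 0) + 1) (set_reg 5 (take_bit w 1) (init_config T))
        (at_state 44 n n i a b (map length Gs))"
      using all_rounds by blast
    have "reaches w T (100 * n + 2) (init_config T) (at_state 44 n n i a b (map length Gs))"
      by (rule reaches_after[OF run1 Gs(2)]) simp
    then obtain t c where "run w T galois_prog t (init_config T) = Some c" "t \<le> 100 * n + 2"
      "at_state 44 n n i a b (map length Gs) c"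
      by (auto elim!: reachesE)
    then show ?thesis
      using Gs(1) by (intro exI[of _ t] exI[of _ c] exI[of _ Gs])
        (auto simp: halts_after_def at_state_def halt length_prog)
  qed
qed

theorem theorem32:
  shows "\<exists>(p :: program) (time :: nat \<Rightarrow> nat) (space :: nat \<Rightarrow> nat).
     (\<lambda>n. real (time n)) \<in> O(\<lambda>n. real n) \<and>
     (\<lambda>n. real (space n)) \<in> O(\<lambda>_. 1) \<and>
     (\<forall>(T :: 'a::linorder list) (w :: nat). length T < 2 ^ w \<longrightarrow>
        (\<exists>t c Gs. halts_after w T p t c \<and>
                  galois_factorization T Gs \<and> out c = map length Gs \<and>
                  t \<le> time (length T) \<and> space_used p c \<le> space (length T)))"
\<comment> \<open>The program is fixed for all texts and word lengths; since \<open>touched\<close>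
  stays empty, its registers are the whole working space.\<close>
proof (rule exI[of _ galois_prog], rule exI[of _ "\<lambda>n. 100 * n + 2"],
    rule exI[of _ "\<lambda>_. card (\<Union>i\<in>set galois_prog. regs i)"], intro conjI allI impI)
  have "eventually (\<lambda>n::nat. norm (real (100 * n + 2)) \<le> 102 * norm (real n)) at_top"
    using eventually_ge_at_top[of 1] by eventually_elim auto
  then show "(\<lambda>n. real (100 * n + 2)) \<in> O(\<lambda>n. real n)"
    by (rule bigoI)
  show "(\<lambda>n::nat. real (card (\<Union>i\<in>set galois_prog. regs i))) \<in> O(\<lambda>_. 1)"
    by simp
  fix T :: "'a list" and w :: nat
  assume "length T < 2 ^ w"
  then obtain t c Gs where "halts_after w T galois_prog t c" "galois_factorization T Gs"
    "out c = map length Gs" "t \<le> 100 * length T + 2" "touched c = {}"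
    using galois_prog_correct by blast
  then show "\<exists>t c Gs. halts_after w T galois_prog t c \<and> galois_factorization T Gs \<and>
    out c = map length Gs \<and> t \<le> 100 * length T + 2 \<and>
    space_used galois_prog c \<le> card (\<Union>i\<in>set galois_prog. regs i)"
    by (intro exI[of _ t] exI[of _ c] exI[of _ Gs]) (simp add: space_used_def)
qed

end
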